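(* Let $G$ be a finite simple undirected $P_6$-free graph that has an efficient dominating set $D$, and let $C$ be an odd antihole in $G^2$ with vertex set $R(C)$. Then $|D\cap R(C)|=0$.
   Context: All graphs are finite, undirected and simple. A vertex dominates itself and its neighbors. A set $D\subseteq V$ is an efficient dominating set of $G=(V,E)$ if every vertex of $G$ is dominated by exactly one vertex of $D$. The square $G^2=(V,E^2)$ has $uv\in E^2$ iff $d_G(u,v)\in\{1,2\}$. $P_6$-free means having no induced chordless path on 6 vertices. An odd antihole in $G^2$ is an induced subgraph of $G^2$ isomorphic to the complement $\overline{C_{2k+1}}$ of a chordless cycle with $2k+1$ vertices, $k\ge 2$; its vertices are called its real vertices, and $R(C)$ denotes the set of real vertices of $C$. *)

theory Defs
  imports "Graph_Theory.Graph_Theory"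
begin

text \<open>
  Finite simple undirected graphs are the \<^locale>\<open>pair_graph\<close>s: finite, loop-free and symmetric,
  each edge being represented by its two orientations. The coercion \<^const>\<open>with_proj\<close> into
  \<^typ>\<open>('a, 'b) pre_digraph\<close> is inserted silently by the library.
\<close>

text \<open>Distance: every arc has weight 1; the value is infinite between different components.\<close>

definition graph_dist :: "'a pair_pre_digraph \<Rightarrow> 'a \<Rightarrow> 'a \<Rightarrow> ereal" where
  "graph_dist G u v = wf_digraph.\<mu> (with_proj G) (\<lambda>_. 1) u v"

definition graph_square :: "'a pair_pre_digraph \<Rightarrow> 'a pair_pre_digraph" where
  "graph_square G = \<lparr> pverts = pverts G,
     parcs = {(u, v). u \<in> pverts G \<and> v \<in> pverts G \<and> graph_dist G u v \<in> {1, 2}} \<rparr>"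

definition graph_complement :: "'a pair_pre_digraph \<Rightarrow> 'a pair_pre_digraph" where
  "graph_complement G = \<lparr> pverts = pverts G,
     parcs = {(u, v). u \<in> pverts G \<and> v \<in> pverts G \<and> u \<noteq> v \<and> (u, v) \<notin> parcs G} \<rparr>"

text \<open>\<open>path_graph n\<close> and \<open>cycle_graph n\<close> have \<open>n\<close> vertices; the latter is meant for \<open>n \<ge> 3\<close>.\<close>

definition path_graph :: "nat \<Rightarrow> nat pair_pre_digraph" where
  "path_graph n = \<lparr> pverts = {..<n},
     parcs = {(i, j). i < n \<and> j < n \<and> (j = Suc i \<or> i = Suc j)} \<rparr>"

definition cycle_graph :: "nat \<Rightarrow> nat pair_pre_digraph" where
  "cycle_graph n = \<lparr> pverts = {..<n},
     parcs = {(i, j). i < n \<and> j < n \<and> (j = Suc i mod n \<or> i = Suc j mod n)} \<rparr>"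

definition path_free :: "nat \<Rightarrow> 'a pair_pre_digraph \<Rightarrow> bool" where
  "path_free n G \<longleftrightarrow> \<not> (\<exists>H :: 'a pair_pre_digraph.
     induced_subgraph (with_proj H) (with_proj G) \<and>
     digraph_iso (with_proj H) (with_proj (path_graph n)))"

definition odd_antihole_in :: "'a pair_pre_digraph \<Rightarrow> 'a pair_pre_digraph \<Rightarrow> bool" where
  "odd_antihole_in C H \<longleftrightarrow>
     induced_subgraph (with_proj C) (with_proj H) \<and>
     (\<exists>k\<ge>2. digraph_iso (with_proj C) (with_proj (graph_complement (cycle_graph (2 * k + 1)))))"

text \<open>Unlike the library's \<^const>\<open>dominates\<close>, which is adjacency, a vertex dominates itself here.\<close>

definition vertex_dominates :: "'a pair_pre_digraph \<Rightarrow> 'a \<Rightarrow> 'a \<Rightarrow> bool" where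
  "vertex_dominates G d v \<longleftrightarrow> d = v \<or> (d, v) \<in> parcs G"

definition efficient_dominating_set :: "'a pair_pre_digraph \<Rightarrow> 'a set \<Rightarrow> bool" where
  "efficient_dominating_set G D \<longleftrightarrow>
     D \<subseteq> pverts G \<and> (\<forall>v\<in>pverts G. \<exists>!d. d \<in> D \<and> vertex_dominates G d v)"

end

theory Submission
  imports Defs
begin

text \<open>
  Number the antihole so that \<open>v 0 = x \<in> D\<close> and exactly the cyclically consecutive vertices have
  distance at least 3. Two second neighbours of \<open>x\<close> at distance at least 3 would yield an induced
  \<open>P\<^sub>6\<close> through their dominators, so membership in the neighbourhood of \<open>x\<close> alternates along
  \<open>v 2, \<dots>, v (2k - 1)\<close>. The number of these vertices is even, so one end \<open>a\<close> is a neighbour of \<open>x\<close>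
  and the other end \<open>b\<close> is not. Together with the two vertices \<open>y, z\<close> far from \<open>x\<close> they form a
  5-cycle \<open>x a z y b\<close> in the square, possibly with the chord \<open>a b\<close>; a vertex \<open>q\<close> of the antihole next
  to \<open>b\<close>, which is again a neighbour of \<open>x\<close> (\<open>q = a\<close> if \<open>k = 2\<close>), excludes this configuration.
\<close>

section \<open>Six-vertex paths and efficient domination\<close>

locale p6_free_eds =
  fixes E :: "'a \<Rightarrow> 'a \<Rightarrow> bool" and V D :: "'a set"
  assumes sym: "E u v \<Longrightarrow> E v u"
    and irrefl: "\<not> E u u"
    and in_V: "E u v \<Longrightarrow> u \<in> V"
    and ex_dominator: "v \<in> V \<Longrightarrow> \<exists>d\<in>D. d = v \<or> E d v"
    and dominator_unique: "\<lbrakk>v \<in> V; d \<in> D; e \<in> D; d = v \<or> E d v; e = v \<or> E e v\<rbrakk> \<Longrightarrow> d = e"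
    and no_P6: "\<lbrakk>E a b; E b c; E c d; E d e; E e f;
      \<not> E a c; \<not> E a d; \<not> E a e; \<not> E a f; \<not> E b d; \<not> E b e; \<not> E b f; \<not> E c e; \<not> E c f; \<not> E d f\<rbrakk>
      \<Longrightarrow> False"
begin

text \<open>For vertices of the graph this is distance at least 3, infinity included: distinct and
  non-adjacent in the square.\<close>

definition far :: "'a \<Rightarrow> 'a \<Rightarrow> bool" where
  "far u v \<longleftrightarrow> u \<noteq> v \<and> \<not> E u v \<and> (\<forall>m. E u m \<longrightarrow> \<not> E m v)"

lemma non_sym: "\<not> E u v \<Longrightarrow> \<not> E v u"
  using sym by blast

lemma far_sym: "far u v \<Longrightarrow> far v u"
  unfolding far_def using sym by blast

lemma farD:
  assumes "far u v"
  shows "u \<noteq> v" "\<not> E u v" "E u m \<Longrightarrow> \<not> E m v" "E v m \<Longrightarrow> \<not> E m u"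
  using assms far_sym[OF assms] unfolding far_def by auto

text \<open>Since \<open>x\<close> already dominates \<open>u\<close> and \<open>u'\<close>, neither
  \<open>b\<close> nor \<open>b'\<close> is in \<open>D\<close>, and their dominators see neither
  \<open>u\<close> nor \<open>u'\<close>. Prolonging by these dominators gives an induced path on
  six vertices.\<close>

lemma no_far_second_neighbors:
  assumes x: "x \<in> D" and b: "x \<noteq> b" "\<not> E x b" "E x u" "E u b"
    and b': "x \<noteq> b'" "\<not> E x b'" "E x u'" "E u' b'"
    and far: "far b b'"
  shows False
proof -
  have dom: "\<exists>d\<in>D. E d c \<and> d \<noteq> c" if c: "x \<noteq> c" "\<not> E x c" "E x v" "E v c" for c v
  proof -
    obtain d where d: "d \<in> D" "d = c \<or> E d c"
      using ex_dominator[of c] in_V sym c(4) by blast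
    have "c \<notin> D" using dominator_unique[of v x c] in_V sym c x by blast
    with d show ?thesis using irrefl by blast
  qed
  obtain d where d: "d \<in> D" "E d b" using dom[OF b] by blast
  obtain d' where d': "d' \<in> D" "E d' b'" using dom[OF b'] by blast
  have dx: "e = x" if "e \<in> D" "E e v" "E x v" for e v
    using dominator_unique[of v e x] that x in_V sym by blast
  have adj_D: "\<not> E e e'" if "e \<in> D" "e' \<in> D" for e e'
    using dominator_unique[of e' e e'] that in_V sym irrefl by blast
  have ne: "d \<noteq> x" "d' \<noteq> x" using d d' b b' by auto
  have "\<not> E d b'" "\<not> E d' b" "\<not> E b u'" "\<not> E u b'"
    using farD[OF far] d d' b b' sym by blast+
  moreover have "\<not> E d u" "\<not> E d u'" "\<not> E d' u" "\<not> E d' u'"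
    using dx d d' ne b b' by blast+
  moreover have "\<not> E d x" "\<not> E d' x" "\<not> E d d'" using adj_D d d' x by blast+
  ultimately have non: "\<not> E d b'" "\<not> E d' b" "\<not> E b u'" "\<not> E u b'" "\<not> E d u" "\<not> E d u'"
    "\<not> E d' u" "\<not> E d' u'" "\<not> E d x" "\<not> E d' x" "\<not> E d d'" "\<not> E b b'" "\<not> E x b" "\<not> E x b'"
    using b b' farD[OF far] by auto
  \<comment> \<open>Both orientations are listed, so that the simplifier can decide the premises of
    \<open>no_P6\<close>.\<close>
  note lits = non non[THEN non_sym] d(2) d'(2) b(3,4) b'(3,4)
    d(2)[THEN sym] d'(2)[THEN sym] b(3,4)[THEN sym] b'(3,4)[THEN sym]
  \<comment> \<open>The first path can only have the chord \<open>u u'\<close>, and this chord is an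
    edge of the second path.\<close>
  show False
    using no_P6[of d b u x u' b'] no_P6[of d b u u' b' d'] by (auto simp: lits)
qed

text \<open>Most steps exhibit a path on six vertices with one undecided pair, which
  \<open>no_P6\<close> then decides. This pins down how the connecting vertices \<open>u\<close>,
  \<open>w\<close>, \<open>c\<close>, \<open>t\<close> see each other, until the dominators of
  \<open>b\<close>, \<open>y\<close>, \<open>z\<close> leave a path with no possible chord.\<close>

lemma no_house:
  assumes x: "x \<in> D" and a: "E x a" and q: "E x q"
    and xy: "far x y" and xz: "far x z" and ya: "far y a" and bz: "far b z" and qb: "far q b"
    and b: "x \<noteq> b" "\<not> E x b" "E x u" "E u b"
    and az: "E a z \<or> (\<exists>m. E a m \<and> E m z)"
    and by': "E b y \<or> (\<exists>m. E b m \<and> E m y)"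
    and yz: "E y z \<or> (\<exists>m. E y m \<and> E m z)"
  shows False
proof -
  \<comment> \<open>The edge \<open>a z\<close> would make \<open>a\<close> a common neighbour of
    the far pair \<open>x, z\<close>.\<close>
  obtain w where w: "E a w" "E w z" using az farD(3)[OF xz a] by blast
  have nbr_x: "\<not> E v y" "\<not> E v z" if "E x v" for v using that xy xz farD by blast+
  have nbr_b: "\<not> E v z" "\<not> E v q" if "E b v" for v using that bz qb farD sym by blast+
  have nbr_y: "\<not> E v x" "\<not> E v a" if "E y v" for v using that xy ya farD sym by blast+
  have nbr_z: "\<not> E v x" "\<not> E v b" if "E z v" for v using that xz bz farD sym by blast+
  have bu: "E b u" and zw: "E z w" using b w sym by blast+
  have non: "\<not> E x y" "\<not> E x z" "\<not> E y a" "\<not> E b z" "\<not> E q b" "\<not> E x b"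
    "\<not> E w x" "\<not> E w b" "\<not> E w y" "\<not> E u q" "\<not> E u y" "\<not> E u z" "\<not> E a z" "\<not> E q y" "\<not> E q z"
    using farD[OF xy] farD[OF xz] farD[OF ya] farD[OF bz] farD[OF qb] b a q w
      nbr_x nbr_b[OF bu] nbr_z[OF zw] sym by blast+
  note pos = a q b(3,4) w
  note lits = non non[THEN non_sym] pos pos[THEN sym] b(1,2)
  have c: "E c b" "E c y" "E b c" "E y c" "\<not> E c x" "\<not> E c a" "\<not> E c z" "\<not> E c q"
    "\<not> E x c" "\<not> E a c" "\<not> E z c" "\<not> E q c" if "E b c" "E c y" for c
    using that nbr_y[of c] nbr_b[of c] sym by blast+
  \<comment> \<open>With the edge \<open>y z\<close>, the chord \<open>u c\<close> is forced, and it
    shortens the path enough to start it at \<open>q\<close>.\<close>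
  have nyz: "\<not> E y z"
  proof
    assume 1: "E y z"
    then have "\<not> E b y" using farD(3)[OF bz] by blast
    then obtain c where "E b c" "E c y" using by' by blast
    note c = c[OF this]
    have "E u c" using no_P6[of x u b c y z]
      by (auto simp: lits c 1 \<open>\<not> E b y\<close>)
    then show False using no_P6[of q x u c y z] by (auto simp: lits c 1)
  qed
  then have nzy: "\<not> E z y" using sym by blast
  have t: "E t z" "E t y" "E z t" "E y t" "\<not> E t x" "\<not> E t a" "\<not> E t b"
    "\<not> E x t" "\<not> E a t" "\<not> E b t" if "E y t" "E t z" for t
    using that nbr_y[of t] nbr_z[of t] sym by blast+
  obtain t where yt: "E y t" "E t z" using yz nyz by blast
  note lits = lits nyz nzy t[OF yt]
  \<comment> \<open>With the edge \<open>a b\<close>, an induced path remains whether or not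
    \<open>c t\<close> is an edge.\<close>
  have nab: "\<not> E a b"
  proof
    assume 1: "E a b"
    then have "\<not> E b y" "\<not> E y b" using farD(4)[OF ya] sym by blast+
    then obtain c where "E b c" "E c y" using by' by blast
    note lits = lits c[OF this] 1 1[THEN sym] \<open>\<not> E b y\<close> \<open>\<not> E y b\<close>
    have "E c t" using no_P6[of x a b c y t] by (auto simp: lits)
    then show False using no_P6[of x a b c t z] by (auto simp: lits)
  qed
  note lits = lits nab nab[THEN non_sym]
  \<comment> \<open>Only \<open>t w\<close> can be a chord of this path.\<close>
  have tw: "E t w" using no_P6[of x a w z t y] sym by (auto simp: lits)
  note lits = lits tw tw[THEN sym]
  have nby: "\<not> E b y"
  proof
    assume 1: "E b y"
    show False using no_P6[of x a w t y b] by (auto simp: lits 1 1[THEN sym])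
  qed
  then obtain c where bc: "E b c" "E c y" using by' by blast
  note lits = lits nby nby[THEN non_sym]
  \<comment> \<open>Here and in \<open>ut\<close> the common neighbour is arbitrary: via
    \<open>cD\<close> and \<open>tD\<close> the facts are later applied to the dominators
    \<open>dB\<close> and \<open>dY\<close>.\<close>
  have uc: "E u c" if "E b c" "E c y" for c
    using no_P6[of q x u b c y] c[OF that] by (auto simp: lits)
  have ut: "E u t" if "E y t" "E t z" for t
  proof (rule ccontr)
    assume 1: "\<not> E u t"
    note lits = lits c[OF bc] t[OF that] uc[OF bc] 1 1[THEN non_sym]
    have 2: "\<not> E q t" using no_P6[of b u x q t y] by (auto simp: lits)
    have "E c t" using no_P6[of q x u c y t] by (auto simp: lits 2)
    then show False using no_P6[of q x u c t z] by (auto simp: lits 2)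
  qed
  \<comment> \<open>From here on \<open>u\<close>, a neighbour of \<open>x\<close>, sees both
    \<open>c\<close> and \<open>t\<close>.\<close>
  note lits = lits c[OF bc] uc[OF bc] uc[OF bc, THEN sym] ut[OF yt] ut[OF yt, THEN sym]
  have cw: "E c w"
  proof (rule ccontr)
    assume 1: "\<not> E c w"
    note lits = lits 1 1[THEN non_sym]
    have "E c t" using no_P6[of c y t w a x] by (auto simp: lits)
    then show False using no_P6[of b c t w a x] by (auto simp: lits)
  qed
  note lits = lits cw cw[THEN sym]
  have inV: "b \<in> V" "y \<in> V" "z \<in> V" "c \<in> V" "t \<in> V" "w \<in> V"
    using lits in_V by blast+
  obtain dB dY dZ where d: "dB \<in> D" "dB = b \<or> E dB b" "dY \<in> D" "dY = y \<or> E dY y"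
    "dZ \<in> D" "dZ = z \<or> E dZ z"
    using ex_dominator[OF inV(1)] ex_dominator[OF inV(2)] ex_dominator[OF inV(3)] by blast
  \<comment> \<open>Otherwise \<open>m\<close> would be dominated both by \<open>x\<close> and by
    \<open>v\<close>.\<close>
  have nD: "v \<notin> D" if "E x m" "E m v" "x \<noteq> v" for m v
    using dominator_unique[of m x v] that x in_V sym by blast
  have ndx: "\<not> E e m" if "e \<in> D" "E x m" "e \<noteq> x" for m e
    using nD that sym by blast
  have uniq: "\<not> E e v" if "f \<in> D" "f = v \<or> E f v" "e \<in> D" "e \<noteq> f" "v \<in> V" for e f v
    using dominator_unique[of v e f] that by blast
  have dx: "dB \<noteq> x" "dY \<noteq> x" "dZ \<noteq> x"
    using d lits farD(1)[OF xy] farD(1)[OF xz] by auto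
  have "b \<notin> D" using nD[OF b(3,4) b(1)] .
  then have Bb: "E dB b" using d by blast
  have cD: "c \<notin> D" if "E b c" "E c y" for c
    using nD[of u c] uc[OF that] c(1)[OF that] b by blast
  have tD: "t \<notin> D" if "E y t" "E t z" for t
    using nD[of u t] ut[OF that] t(1)[OF that] b farD(2)[OF xz] by blast
  txt \<open>Common neighbours of \<open>b, y\<close> and of \<open>y, z\<close> see \<open>u\<close>, which \<open>x\<close> dominates; so the
    dominators of \<open>b\<close>, \<open>y\<close>, \<open>z\<close> are distinct. The one of \<open>y\<close> is then forced to dominate \<open>c\<close> and \<open>t\<close>,
    which leaves the path \<open>dB b c t z dZ\<close> without chords.\<close>
  have By: "\<not> E dB y" using cD[of dB] d Bb sym by blast
  have BY: "dB \<noteq> dY" using By d(4) Bb nby[THEN non_sym] by auto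
  have Bz: "\<not> E dB z" using nbr_b Bb sym by blast
  have BZ: "dB \<noteq> dZ" using Bz d(6) Bb non(4)[THEN non_sym] by auto
  have yz_ne: "y \<noteq> z" using t(2)[OF yt] cw c(4)[OF bc] c(7)[OF bc] sym by blast
  have YZ: "dY \<noteq> dZ" using tD[of dY] d(3,4,6) nyz nzy yz_ne sym[of dY y] by auto
  have adj_D: "\<not> E e f" if "e \<in> D" "f \<in> D" for e f
    using uniq[of f f e] that irrefl in_V[OF sym] by blast
  note dD = d(1,3,5)
  \<comment> \<open>None of the three dominators is adjacent to \<open>u\<close>, \<open>q\<close>,
    \<open>a\<close> or \<open>x\<close>.\<close>
  note non2 = dD[THEN ndx, OF b(3)] dD[THEN ndx, OF q] dD[THEN ndx, OF a]
  note non2 = non2(1)[OF dx(1)] non2(2)[OF dx(2)] non2(3)[OF dx(3)]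
    non2(4)[OF dx(1)] non2(5)[OF dx(2)] non2(6)[OF dx(3)]
    non2(7)[OF dx(1)] non2(8)[OF dx(2)] non2(9)[OF dx(3)] dD[THEN adj_D, OF x]
  have non3: "\<not> E dY b" "\<not> E dZ b" "\<not> E dY z" "\<not> E dZ y"
    using uniq[OF d(1,2,3) BY[symmetric] inV(1)] uniq[OF d(1,2,5) BZ[symmetric] inV(1)]
      uniq[OF d(5,6,3) YZ inV(3)] uniq[OF d(3,4,5) YZ[symmetric] inV(2)] .
  note non3 = non3 adj_D[OF d(1,3)] adj_D[OF d(1,5)] adj_D[OF d(3,5)]
  note lits = lits Bb Bb[THEN sym] By By[THEN non_sym] Bz Bz[THEN non_sym]
    non2 non2[THEN non_sym] non3 non3[THEN non_sym]
  have Yc: "E dY c"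
  proof (rule ccontr)
    assume 1: "\<not> E dY c"
    \<comment> \<open>The alternative \<open>dY = y\<close> is out, because \<open>y\<close> is
      adjacent to \<open>c\<close>.\<close>
    then have "E dY y" using d lits by blast
    then show False using no_P6[of dY y c u x q] by (auto simp: lits 1)
  qed
  have Bc: "\<not> E dB c" using uniq[of dY c dB] Yc d BY inV by blast
  \<comment> \<open>Only \<open>dB w\<close> can be a chord here. So \<open>dB\<close> dominates
    \<open>w\<close>, which bars \<open>dY\<close> from it and clears the path used for
    \<open>Yt\<close>.\<close>
  have Bw: "E dB w" using no_P6[of dB b c w a x] by (auto simp: lits Bc)
  have Yw: "\<not> E dY w" using uniq[of dB w dY] Bw d BY inV by blast
  have Yt: "E dY t"
  proof (rule ccontr)
    assume 1: "\<not> E dY t"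
    then have "E dY y" using d lits by blast
    then show False using no_P6[of dY y t w a x] by (auto simp: lits 1 Yw)
  qed
  have Bt: "\<not> E dB t" using uniq[of dY t dB] Yt d BY inV by blast
  have ct: "E c t"
    using no_P6[of dB b c dY t z] by (auto simp: lits Bc Bt Yt Yc Yc[THEN sym])
  have Zc: "\<not> E dZ c" using uniq[of dY c dZ] Yc d YZ inV by blast
  have Zt: "\<not> E dZ t" using uniq[of dY t dZ] Yt d YZ inV by blast
  \<comment> \<open>The alternative \<open>dZ = z\<close> is out, because \<open>z\<close> is
    adjacent to \<open>t\<close> and \<open>dZ\<close> is not.\<close>
  have "E z dZ" using d Zt lits sym by blast
  then show False
    using no_P6[of dB b c t z dZ]
    by (auto simp: lits Bc Bt ct non_sym[OF Zc] non_sym[OF Zt])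
qed

section \<open>Alternation around the antihole\<close>

lemma no_antihole:
  fixes v :: "nat \<Rightarrow> 'a"
  assumes k: "k \<ge> 2"
    and v: "\<And>i j. \<lbrakk>i < j; j \<le> 2 * k\<rbrakk> \<Longrightarrow>
      v i \<noteq> v j \<and> (far (v i) (v j) \<longleftrightarrow> j = Suc i \<or> i = 0 \<and> j = 2 * k)"
  shows "v 0 \<notin> D"
proof
  assume x: "v 0 \<in> D"
  let ?N = "\<lambda>i. E (v 0) (v i)"
  have near: "E (v i) (v j) \<or> (\<exists>m. E (v i) m \<and> E m (v j))"
    if "i < j" "j \<le> 2 * k" "j \<noteq> Suc i" "i \<noteq> 0 \<or> j \<noteq> 2 * k" for i j
    using v[OF that(1,2)] that(3,4) unfolding far_def by blast
  have near_sym: "E (v j) (v i) \<or> (\<exists>m. E (v j) m \<and> E m (v i))"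
    if "i < j" "j \<le> 2 * k" "j \<noteq> Suc i" "i \<noteq> 0 \<or> j \<noteq> 2 * k" for i j
    using near[OF that] sym by blast
  have far_Suc: "far (v i) (v (Suc i))" if "i < 2 * k" for i
    using v[of i "Suc i"] that by simp
  have far_last: "far (v 0) (v (2 * k))" using v[of 0 "2 * k"] k by simp
  have second: "\<exists>u. E (v 0) u \<and> E u (v i)" "v 0 \<noteq> v i" if "2 \<le> i" "i < 2 * k" "\<not> ?N i" for i
    using near[of 0 i] v[of 0 i] that by auto
  have alternate: "?N (Suc i) \<longleftrightarrow> \<not> ?N i" if i: "2 \<le> i" "Suc i < 2 * k" for i
  proof -
    \<comment> \<open>Otherwise \<open>v 0\<close> would be a common neighbour of a far
      pair.\<close>
    have "\<not> (?N i \<and> ?N (Suc i))"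
      using farD(3)[OF far_Suc[of i], of "v 0"] i sym by auto
    moreover have "?N i \<or> ?N (Suc i)"
      using no_far_second_neighbors[OF x _ _ _ _ _ _ _ _ far_Suc[of i]] second[of i] second[of "Suc i"] i
      by (metis Suc_lessD le_SucI)
    ultimately show ?thesis by blast
  qed
  have parity: "?N i \<longleftrightarrow> (even i \<longleftrightarrow> ?N 2)" if "2 \<le> i" "i < 2 * k" for i
    using that
  proof (induction i rule: nat_induct_at_least)
    case (Suc n)
    then show ?case using alternate[of n] by auto
  qed simp
  \<comment> \<open>The indices \<open>2 * k - 2\<close> and \<open>2 * k - 1\<close> become
    \<open>Suc m\<close> and \<open>Suc (Suc m)\<close>, free of truncated subtraction.\<close>
  define m where "m = 2 * k - 3"
  have m: "2 * k = Suc (Suc (Suc m))" "odd m" "1 \<le> m" using k by (auto simp: m_def)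
  have N: "?N 3 \<longleftrightarrow> \<not> ?N 2" "?N (Suc m) \<longleftrightarrow> ?N 2" "?N (Suc (Suc m)) \<longleftrightarrow> \<not> ?N 2"
    using parity[of 3] parity[of "Suc m"] parity[of "Suc (Suc m)"] m k by auto
  have f: "far (v 0) (v 1)" "far (v 1) (v 2)" "far (v 2) (v 3)"
    using far_Suc[of 0] far_Suc[of 1] far_Suc[of 2] k by (simp_all add: numeral_eq_Suc)
  have f': "far (v (Suc m)) (v (Suc (Suc m)))" "far (v (Suc (Suc m))) (v (2 * k))"
    using far_Suc[of "Suc m"] far_Suc[of "Suc (Suc m)"] m by simp_all
  show False
  proof (cases "?N 2")
    case True
    with N have N: "?N (Suc m)" "\<not> ?N (Suc (Suc m))" by auto
    obtain u where u: "E (v 0) u" "E u (v (Suc (Suc m)))" "v 0 \<noteq> v (Suc (Suc m))"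
      using second[of "Suc (Suc m)"] N(2) m by auto
    \<comment> \<open>Roles: \<open>a = v 2\<close>, \<open>q = v (2 * k - 2)\<close>,
      \<open>b = v (2 * k - 1)\<close>, \<open>y = v 1\<close>,
      \<open>z = v (2 * k)\<close>.\<close>
    show False
      using no_house[OF x True N(1) f(1) far_last f(2) f'(2,1) u(3) N(2) u(1,2)
          near[of 2 "2 * k"] near_sym[of 1 "Suc (Suc m)"] near[of 1 "2 * k"]] m
      by simp
  next
    case False
    with N have N: "?N 3" "?N (Suc (Suc m))" by auto
    obtain u where u: "E (v 0) u" "E u (v 2)" "v 0 \<noteq> v 2"
      using second[of 2] False k by auto
    \<comment> \<open>The same configuration reflected by \<open>i\<close> to
      \<open>2 * k + 1 - i\<close>: \<open>a = v (2 * k - 1)\<close>, \<open>q = v 3\<close>,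
      \<open>b = v 2\<close>, \<open>y = v (2 * k)\<close>, \<open>z = v 1\<close>.\<close>
    show False
      using no_house[OF x N(2,1) far_last f(1) far_sym[OF f'(2)] far_sym[OF f(2)] far_sym[OF f(3)]
          u(3) False u(1,2) near_sym[of 1 "Suc (Suc m)"] near[of 2 "2 * k"] near_sym[of 1 "2 * k"]] m
      by simp
  qed
qed

end

section \<open>Isomorphisms and induced paths of pair digraphs\<close>

text \<open>Arcs are pairs of vertices, so the vertex map \<open>g\<close> induces the arc map
  \<open>map_prod g g\<close>.\<close>

lemma digraph_iso_imageI:
  assumes "wf_digraph (with_proj H)" and "inj_on g (pverts H)"
    and "pverts K = g ` pverts H" and "parcs K = map_prod g g ` parcs H"
  shows "digraph_iso (with_proj H) (with_proj K)"
proof -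
  interpret wf_digraph "with_proj H" by fact
  have sub: "parcs H \<subseteq> pverts H \<times> pverts H"
    using tail_in_verts head_in_verts by fastforce
  let ?f = "\<lparr> iso_verts = g, iso_arcs = map_prod g g, iso_head = snd, iso_tail = fst \<rparr>"
  have "inj_on (map_prod g g) (parcs H)"
    using map_prod_inj_on[OF assms(2,2)] sub inj_on_subset by blast
  then have "digraph_isomorphism ?f"
    unfolding digraph_isomorphism_def using assms(1,2) by auto
  moreover have "with_proj K = app_iso ?f (with_proj H)"
    unfolding app_iso_def using assms(3,4) by (simp add: with_proj_def)
  ultimately show ?thesis unfolding digraph_iso_def by blast
qed

text \<open>An isomorphism carries its own arc map, tail and head. As both digraphs come from
  \<open>with_proj\<close>, tail and head are the projections, which forces the arc map to act by
  the vertex map on both ends.\<close>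

lemma digraph_isoE:
  assumes "digraph_iso (with_proj H) (with_proj K)"
  obtains g where "bij_betw g (pverts H) (pverts K)"
    and "\<And>u v. \<lbrakk>u \<in> pverts H; v \<in> pverts H\<rbrakk> \<Longrightarrow> (u, v) \<in> parcs H \<longleftrightarrow> (g u, g v) \<in> parcs K"
proof -
  obtain f where f: "pre_digraph.digraph_isomorphism (with_proj H) f"
    and K: "with_proj K = app_iso f (with_proj H)"
    using assms unfolding digraph_iso_def by blast
  interpret wf_digraph "with_proj H"
    using f unfolding pre_digraph.digraph_isomorphism_def by simp
  let ?g = "iso_verts f"
  have verts: "pverts K = ?g ` pverts H" and arcs: "parcs K = iso_arcs f ` parcs H"
    and ends: "fst = iso_tail f" "snd = iso_head f"
    using arg_cong[OF K, of verts] arg_cong[OF K, of arcs] arg_cong[OF K, of tail] arg_cong[OF K, of head]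
    by auto
  have inj: "inj_on ?g (pverts H)"
    using f unfolding digraph_isomorphism_def by simp
  have "iso_arcs f e = map_prod ?g ?g e" if "e \<in> parcs H" for e
    using f that unfolding digraph_isomorphism_def ends[symmetric]
    by (auto simp: prod_eq_iff)
  then have arcs: "parcs K = map_prod ?g ?g ` parcs H"
    unfolding arcs by (rule image_cong[OF refl])
  have sub: "parcs H \<subseteq> pverts H \<times> pverts H"
    using tail_in_verts head_in_verts by fastforce
  have "(u, v) \<in> parcs H \<longleftrightarrow> (?g u, ?g v) \<in> parcs K" if "u \<in> pverts H" "v \<in> pverts H" for u v
    unfolding arcs using sub that inj by (auto simp: inj_on_eq_iff)
  then show thesis using that[of ?g] inj verts by (simp add: bij_betw_def)
qed

lemma not_path_freeI:
  assumes "pair_wf_digraph G" and inj: "inj_on p {..<n}" and p: "p ` {..<n} \<subseteq> pverts G"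
    and adj: "\<And>i j. \<lbrakk>i < n; j < n\<rbrakk> \<Longrightarrow> (p i, p j) \<in> parcs G \<longleftrightarrow> j = Suc i \<or> i = Suc j"
  shows "\<not> path_free n G"
proof -
  interpret pair_wf_digraph G by fact
  let ?S = "p ` {..<n}"
  define H where "H = \<lparr> pverts = ?S, parcs = parcs G \<inter> ?S \<times> ?S \<rparr>"
  have wf: "wf_digraph (with_proj H)" by unfold_locales (auto simp: H_def)
  have "induced_subgraph (with_proj H) (with_proj G)"
    unfolding induced_subgraph_def subgraph_def compatible_def
    using p wf wf_digraph_axioms by (auto simp: H_def)
  moreover have "digraph_iso (with_proj H) (with_proj (path_graph n))"
  proof (rule digraph_iso_imageI[OF wf])
    \<comment> \<open>The isomorphism goes from \<open>H\<close> to the standard path, hence the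
      inverse of \<open>p\<close>.\<close>
    let ?g = "the_inv_into {..<n} p"
    have g: "?g (p i) = i" if "i < n" for i using the_inv_into_f_f[OF inj] that by simp
    show "inj_on ?g (pverts H)" using inj_on_the_inv_into[OF inj] by (simp add: H_def)
    show "pverts (path_graph n) = ?g ` pverts H"
      using the_inv_into_onto[OF inj] by (simp add: H_def path_graph_def)
    show "parcs (path_graph n) = map_prod ?g ?g ` parcs H"
    proof (intro equalityI subsetI)
      fix e assume "e \<in> parcs (path_graph n)"
      then obtain i j where "e = (i, j)" "i < n" "j < n" "j = Suc i \<or> i = Suc j"
        by (auto simp: path_graph_def)
      then show "e \<in> map_prod ?g ?g ` parcs H"
        using adj[of i j] g by (intro image_eqI[of _ _ "(p i, p j)"]) (auto simp: H_def)
    next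
      fix e assume "e \<in> map_prod ?g ?g ` parcs H"
      then obtain i j where "e = (i, j)" "i < n" "j < n" "(p i, p j) \<in> parcs G"
        using g by (auto simp: H_def)
      then show "e \<in> parcs (path_graph n)" using adj[of i j] by (simp add: path_graph_def)
    qed
  qed
  ultimately show ?thesis unfolding path_free_def by blast
qed

section \<open>Distances 1 and 2 by walks\<close>

text \<open>With unit weights the distance is the infimum of walk lengths: an explicit walk bounds
  it from above, the exclusion of shorter walks from below.\<close>

lemma parcs_graph_square_iff:
  assumes "pair_wf_digraph G"
  shows "(u, v) \<in> parcs (graph_square G) \<longleftrightarrow> u \<in> pverts G \<and> v \<in> pverts G \<and> u \<noteq> v \<and>
    ((u, v) \<in> parcs G \<or> (\<exists>m. (u, m) \<in> parcs G \<and> (m, v) \<in> parcs G))"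
proof (cases "u \<in> pverts G \<and> v \<in> pverts G")
  case uv: True
  interpret pair_wf_digraph G by fact
  have cost: "awalk_cost (\<lambda>_. 1) p = real (length p)" for p :: "('a \<times> 'a) list"
    by (induction p) auto
  let ?d = "graph_dist G u v"
  have le: "?d \<le> ereal (real (length p))" if "awalk u p v" for p
    using min_cost_le_walk_cost[OF that, of "\<lambda>_. 1"] unfolding graph_dist_def cost .
  have ge: "ereal (real l) \<le> ?d" if "\<And>p. awalk u p v \<Longrightarrow> l \<le> length p" for l
    unfolding graph_dist_def \<mu>_def using that by (auto simp: le_INF_iff cost)
  have walk0: "u = v" if "awalk u [] v"
    using that by (simp add: awalk_def)
  have walk1: "(u, v) \<in> parcs G" if "awalk u [e] v" for e
    using that by (cases e) (simp add: awalk_def)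
  have walk2: "\<exists>m. (u, m) \<in> parcs G \<and> (m, v) \<in> parcs G" if "awalk u [e, e'] v" for e e'
    using that by (cases e; cases e') (auto simp: awalk_def)
  \<comment> \<open>\<open>remdups_adj.cases\<close> supplies the split into lists of length 0, 1
    and at least 2.\<close>
  have length_cases: "p = [] \<or> (\<exists>e. p = [e]) \<or> (\<exists>e e'. p = [e, e']) \<or> 3 \<le> length p"
    for p :: "('a \<times> 'a) list"
    by (cases p rule: remdups_adj.cases; cases "tl (tl p)") auto
  have arc: "awalk u [(u, v)] v" if "(u, v) \<in> parcs G"
    using that uv by (simp add: awalk_def)
  have two_arcs: "awalk u [(u, m), (m, v)] v" if "(u, m) \<in> parcs G" "(m, v) \<in> parcs G" for m
    using that uv by (simp add: awalk_def)
  have "?d \<in> {1, 2} \<longleftrightarrow> u \<noteq> v \<and> ((u, v) \<in> parcs G \<or> (\<exists>m. (u, m) \<in> parcs G \<and> (m, v) \<in> parcs G))"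
    (is "_ \<longleftrightarrow> _ \<and> (?P \<or> ?Q)")
  proof (cases "u = v")
    case True
    then have "?d \<le> 0" using le[of "[]"] uv by (simp add: awalk_def zero_ereal_def)
    then have "?d \<noteq> 1" "?d \<noteq> 2" by auto
    with True show ?thesis by simp
  next
    case ne: False
    show ?thesis
    proof (cases ?P)
      case True
      have "1 \<le> length p" if "awalk u p v" for p
        using that walk0 ne by (cases p) auto
      from ge[OF this] le[OF arc[OF True]] have "?d = 1" by (simp add: one_ereal_def)
      with True ne show ?thesis by simp
    next
      case nP: False
      show ?thesis
      proof (cases ?Q)
        case True
        then obtain m where m: "(u, m) \<in> parcs G" "(m, v) \<in> parcs G" by blast
        have "2 \<le> length p" if "awalk u p v" for p
          using that walk0 walk1 ne nP length_cases[of p] by auto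
        from ge[OF this] le[OF two_arcs[OF m]] have "?d = 2" by simp
        with True ne show ?thesis by simp
      next
        case nQ: False
        \<comment> \<open>This holds vacuously if no walk exists, so infinite distance is covered
          too.\<close>
        have "3 \<le> length p" if "awalk u p v" for p
          using that walk0 walk1 walk2 ne nP nQ length_cases[of p] by blast
        from ge[OF this] have "?d \<noteq> 1" "?d \<noteq> 2" by auto
        with nP nQ show ?thesis by simp
      qed
    qed
  qed
  then show ?thesis using uv by (simp add: graph_square_def)
qed (auto simp: graph_square_def)

section \<open>Rotating the numbering and transfer to the square\<close>

lemma mod_add_left_cancel_nat:
  fixes c :: nat
  shows "(c + i) mod n = (c + j) mod n \<longleftrightarrow> i mod n = j mod n"
proof -
  have "(c + i) mod n = (c + j) mod n \<longleftrightarrow> i mod n = j mod n" if "j \<le> i" for i j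
    using that by (simp add: mod_eq_dvd_iff_nat)
  from this[of i j] this[of j i] show ?thesis by (metis nat_le_linear)
qed

theorem theorem3:
  fixes G C :: "'a pair_pre_digraph" and D :: "'a set"
  assumes "pair_graph G"
    and "path_free 6 G"
    and "efficient_dominating_set G D"
    and "odd_antihole_in C (graph_square G)"
  shows "card (D \<inter> pverts C) = 0"
proof -
  interpret pair_graph G by fact
  let ?E = "\<lambda>u v. (u, v) \<in> parcs G"
  have sym: "?E v u" if "?E u v" for u v
    using pair_sym_arcs that unfolding symmetric_conv by auto
  have irrefl: "\<not> ?E u u" for u using pair_no_loops by fastforce
  have D: "\<exists>!d. d \<in> D \<and> (d = v \<or> ?E d v)" if "v \<in> pverts G" for v
    using assms(3) that unfolding efficient_dominating_set_def vertex_dominates_def by simp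
  interpret p6_free_eds ?E "pverts G" D
  proof
    fix a b c d e f
    assume path: "?E a b" "?E b c" "?E c d" "?E d e" "?E e f"
      and chordless: "\<not> ?E a c" "\<not> ?E a d" "\<not> ?E a e" "\<not> ?E a f" "\<not> ?E b d" "\<not> ?E b e" "\<not> ?E b f"
        "\<not> ?E c e" "\<not> ?E c f" "\<not> ?E d f"
    note path' = path[THEN sym]
    have chordless': "\<not> ?E c a" "\<not> ?E d a" "\<not> ?E e a" "\<not> ?E f a" "\<not> ?E d b" "\<not> ?E e b" "\<not> ?E f b"
        "\<not> ?E e c" "\<not> ?E f c" "\<not> ?E f d"
      using chordless sym by blast+
    let ?p = "\<lambda>i. [a, b, c, d, e, f] ! i"
    \<comment> \<open>The adjacency pattern alone forces the six vertices to be distinct.\<close>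
    have ne: "a \<noteq> b" "a \<noteq> c" "a \<noteq> d" "a \<noteq> e" "a \<noteq> f" "b \<noteq> c" "b \<noteq> d" "b \<noteq> e" "b \<noteq> f"
      "c \<noteq> d" "c \<noteq> e" "c \<noteq> f" "d \<noteq> e" "d \<noteq> f" "e \<noteq> f"
      using path path' chordless irrefl by metis+
    have six: "{..<6} = {0, 1, 2, 3, 4, 5 :: nat}" by auto
    have "\<not> path_free 6 G"
    proof (rule not_path_freeI[of _ ?p])
      show "inj_on ?p {..<6}"
        unfolding six by (simp add: ne ne[symmetric])
      show "?p ` {..<6} \<subseteq> pverts G"
        unfolding six by (simp add: path[THEN in_arcsD1] path'[THEN in_arcsD1])
      have "\<forall>i\<in>{..<6}. \<forall>j\<in>{..<6}. ?E (?p i) (?p j) \<longleftrightarrow> j = Suc i \<or> i = Suc j"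
        unfolding six by (simp add: path path' chordless chordless' irrefl)
      then show "?E (?p i) (?p j) \<longleftrightarrow> j = Suc i \<or> i = Suc j" if "i < 6" "j < 6" for i j
        using that by blast
    qed (rule pair_wf_digraph_axioms)
    with assms(2) show False by simp
  next
    show "?E v u" if "?E u v" for u v by (rule sym[OF that])
    show "\<not> ?E u u" for u by (rule irrefl)
    show "u \<in> pverts G" if "?E u v" for u v by (rule in_arcsD1[OF that])
    show "\<exists>d\<in>D. d = v \<or> ?E d v" if "v \<in> pverts G" for v
      using ex1_implies_ex[OF D[OF that]] by blast
    show "d = e" if "v \<in> pverts G" "d \<in> D" "e \<in> D" "d = v \<or> ?E d v" "e = v \<or> ?E e v" for v d e
      using ex1E[OF D[OF that(1)]] that(2-) by metis
  qed
  obtain k where k: "k \<ge> 2"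
    and iso: "digraph_iso (with_proj C) (with_proj (graph_complement (cycle_graph (2 * k + 1))))"
    and ind: "induced_subgraph (with_proj C) (with_proj (graph_square G))"
    using assms(4) unfolding odd_antihole_in_def by blast
  let ?n = "2 * k + 1"
  obtain g where g: "bij_betw g (pverts C) {..<?n}"
    and arcs_g: "\<And>u v. \<lbrakk>u \<in> pverts C; v \<in> pverts C\<rbrakk> \<Longrightarrow>
      (u, v) \<in> parcs C \<longleftrightarrow> (g u, g v) \<in> parcs (graph_complement (cycle_graph ?n))"
    using digraph_isoE[OF iso] by (simp add: graph_complement_def cycle_graph_def) blast
  have C_verts: "pverts C \<subseteq> pverts G"
    using ind by (auto simp: induced_subgraph_def subgraph_def graph_square_def)
  \<comment> \<open>An induced subgraph inherits the adjacency of the square, whose failure between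
    distinct vertices is \<open>far\<close>.\<close>
  have C_arcs: "(u, v) \<in> parcs C \<longleftrightarrow> u \<noteq> v \<and> \<not> far u v" if "u \<in> pverts C" "v \<in> pverts C" for u v
    using ind that C_verts parcs_graph_square_iff[OF pair_wf_digraph_axioms, of u v]
    by (auto simp: induced_subgraph_def far_def)
  have False if x: "x \<in> D" "x \<in> pverts C" for x
  proof -
    define h where "h = inv_into (pverts C) g"
    have h: "h i \<in> pverts C" "g (h i) = i" if "i < ?n" for i
      using that g unfolding h_def bij_betw_def by (auto intro: inv_into_into f_inv_into_f)
    \<comment> \<open>Rotation by \<open>g x\<close> puts \<open>x\<close> at position 0.\<close>
    define r where "r i = (g x + i) mod ?n" for i
    have r: "r i < ?n" for i by (simp add: r_def)
    have r_eq: "r i = r j \<longleftrightarrow> i = j" if "i < j" "j \<le> 2 * k" for i j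
      unfolding r_def mod_add_left_cancel_nat using that by simp
    \<comment> \<open>As \<open>i < j\<close>, the second relation can only be the wrap-around from
      the last position to the first.\<close>
    have r_Suc: "r j = Suc (r i) mod ?n \<longleftrightarrow> j = Suc i"
      "r i = Suc (r j) mod ?n \<longleftrightarrow> i = 0 \<and> j = 2 * k" if "i < j" "j \<le> 2 * k" for i j
      unfolding r_def mod_Suc_eq add_Suc_right[symmetric] mod_add_left_cancel_nat using that
      by (auto simp: mod_Suc)
    have "g x < ?n" using g x(2) by (auto simp: bij_betw_def)
    then have "h (r 0) = x"
      using g x(2) unfolding h_def r_def bij_betw_def by (auto intro: inv_into_f_f)
    moreover have "h (r 0) \<notin> D"
    proof (rule no_antihole[OF k, of "\<lambda>i. h (r i)"])
      fix i j assume ij: "i < j" "j \<le> 2 * k"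
      have "h (r i) \<noteq> h (r j)"
        using h(2)[OF r[of i]] h(2)[OF r[of j]] r_eq[OF ij] ij by auto
      moreover have "(h (r i), h (r j)) \<in> parcs C \<longleftrightarrow> \<not> (j = Suc i \<or> i = 0 \<and> j = 2 * k)"
        unfolding arcs_g[OF h(1)[OF r] h(1)[OF r]] h(2)[OF r]
        using r_eq[OF ij] r_Suc[OF ij] ij r[of i] r[of j]
        by (simp add: graph_complement_def cycle_graph_def)
      ultimately show "h (r i) \<noteq> h (r j) \<and> (far (h (r i)) (h (r j)) \<longleftrightarrow> j = Suc i \<or> i = 0 \<and> j = 2 * k)"
        using C_arcs[OF h(1)[OF r] h(1)[OF r]] by blast
    qed
    ultimately show False using x(1) by simp
  qed
  then have "D \<inter> pverts C = {}" by blast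
  then show ?thesis by simp
qed

end
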